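(* Let $|a|<1$ and let $f(x)=a|x|$ for $-1\le x\le 1$. Let $\{X_n^\varepsilon\}_{n\ge 0}$ be the process defined by $X_0^\varepsilon=0$ and $X_{n+1}^\varepsilon=f(X_n^\varepsilon)+\varepsilon\xi_{n+1}$, and let $\tau=\min\{n\ge 1:|X_n^\varepsilon|\ge 1\}$. Then $$\limsup_{\varepsilon\to 0}\varepsilon^2\log E\tau\le\frac{1-a^2}{2}.$$
   Context: Here $\varepsilon>0$ is a small parameter tending to $0$ and $\{\xi_n\}_{n\ge 1}$ is an i.i.d. sequence of standard normal random variables. The function $f$ is specified on $[-1,1]$ and may be extended to a continuous function on $\mathbb{R}$ arbitrarily; only its values on $[-1,1]$ affect the exit time $\tau$. *)

theory Defs
  imports "HOL-Probability.Probability"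
begin

primrec perturbed :: "(real \<Rightarrow> real) \<Rightarrow> (nat \<Rightarrow> 'a \<Rightarrow> real) \<Rightarrow> real \<Rightarrow> nat \<Rightarrow> 'a \<Rightarrow> real" where
  "perturbed f \<xi> \<epsilon> 0 \<omega> = 0"
| "perturbed f \<xi> \<epsilon> (Suc n) \<omega> = f (perturbed f \<xi> \<epsilon> n \<omega>) + \<epsilon> * \<xi> (Suc n) \<omega>"

(* The value is \<infinity> on paths that never leave (-1,1), since Inf {} = \<infinity> in enat. *)
definition exit_time :: "(nat \<Rightarrow> 'a \<Rightarrow> real) \<Rightarrow> 'a \<Rightarrow> enat" where
  "exit_time X \<omega> = Inf (enat ` {n. n \<ge> 1 \<and> \<bar>X n \<omega>\<bar> \<ge> 1})"

(* Natural logarithm on [0,\<infinity>]. With log \<infinity> = \<infinity>, an upper bound on log (E \<tau>)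
   cannot hold through the convention that an integral that diverges is 0. *)
definition ln_ennreal :: "ennreal \<Rightarrow> ereal" where
  "ln_ennreal x = (if x = 0 then -\<infinity> else if x = top then \<infinity> else ereal (ln (enn2real x)))"

end

(* Cut time into blocks of length N. Up to a global sign of the noise, the path before exit
   satisfies |X (n+1)| >= |a| * |X n| + eps * xi (n+1), so a block forces an exit, whatever its
   starting point, if for all i < N its i-th noise is at least t i = c * |a|^(N-1-i) / eps, where
   c = 1 / (sum over l < N of a^(2l)): these are the controls of least energy that steer the
   noiseless system from 0 to 1. Such a block has probability at least p, a lower bound for the
   product of the Gaussian tails at t i, and blocks are independent, so E tau <= N / p, and
   eps^2 * log (N / p) tends to c / 2 as eps -> 0. Finally let N -> infinity. *)

theory Submission
  imports Defs
begin

section \<open>Gaussian tail bounds\<close>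

text \<open>Only the mass on \<open>{t..t+1}\<close> is kept, where the density is at least its
  value at \<open>t + 1\<close>. The shift by 1 is harmless later: \<open>t\<close> will be of order
  1/eps, and eps^2 * (t + 1)^2 and eps^2 * t^2 have the same limit.\<close>

lemma std_normal_tail_lower:
  fixes t :: real
  assumes "0 \<le> t"
  shows "ennreal (exp (- (t + 1)\<^sup>2 / 2) / sqrt (2 * pi)) \<le> (\<integral>\<^sup>+x\<in>{t..}. std_normal_density x \<partial>lborel)"
proof -
  have "ennreal (exp (- (t + 1)\<^sup>2 / 2) / sqrt (2 * pi))
      = (\<integral>\<^sup>+x\<in>{t..t+1}. ennreal (exp (- (t + 1)\<^sup>2 / 2) / sqrt (2 * pi)) \<partial>lborel)"
    by (simp add: nn_integral_cmult_indicator)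
  also have "\<dots> \<le> (\<integral>\<^sup>+x\<in>{t..}. std_normal_density x \<partial>lborel)"
  proof (rule nn_integral_mono)
    fix x :: real
    have "exp (- (t + 1)\<^sup>2 / 2) / sqrt (2 * pi) \<le> std_normal_density x" if "x \<in> {t..t+1}"
    proof -
      have "x\<^sup>2 \<le> (t + 1)\<^sup>2" using that assms by (intro power_mono) auto
      then have "exp (- (t + 1)\<^sup>2 / 2) \<le> exp (- x\<^sup>2 / 2)" by simp
      then show ?thesis by (simp add: std_normal_density_def divide_right_mono)
    qed
    then show "ennreal (exp (- (t + 1)\<^sup>2 / 2) / sqrt (2 * pi)) * indicator {t..t+1} x
        \<le> ennreal (std_normal_density x) * indicator {t..} x"
      by (auto split: split_indicator intro!: ennreal_leI)
  qed
  finally show ?thesis .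
qed

text \<open>The standard normal law is symmetric, so the sign \<open>s\<close> costs nothing. The
  sign is there because for negative \<open>a\<close> the noise has to push downwards.\<close>

lemma (in prob_space) std_normal_signed_tail_lower:
  fixes s t :: real
  assumes X: "distributed M lborel X std_normal_density" and t: "0 \<le> t" and s: "s = 1 \<or> s = -1"
  shows "exp (- (t + 1)\<^sup>2 / 2) / sqrt (2 * pi) \<le> prob {\<omega> \<in> space M. t \<le> s * X \<omega>}"
proof -
  have dist: "distributed M lborel (\<lambda>\<omega>. s * X \<omega>) std_normal_density"
    using s X normal_density_affine[of X 0 1 "-1" 0] by auto
  have "emeasure M {\<omega> \<in> space M. t \<le> s * X \<omega>} = emeasure M ((\<lambda>\<omega>. s * X \<omega>) -` {t..} \<inter> space M)"
    by (rule arg_cong[where f = "emeasure M"]) auto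
  also have "\<dots> = (\<integral>\<^sup>+x\<in>{t..}. std_normal_density x \<partial>lborel)"
    by (rule distributed_emeasure[OF dist]) simp
  finally have "ennreal (exp (- (t + 1)\<^sup>2 / 2) / sqrt (2 * pi)) \<le> emeasure M {\<omega> \<in> space M. t \<le> s * X \<omega>}"
    using std_normal_tail_lower[OF t] by simp
  then show ?thesis
    by (simp add: emeasure_eq_measure)
qed

section \<open>Independent blocks and the geometric tail\<close>

text \<open>Independence is used twice: inside a block for the single noises, which bounds the
  success probability below by the product of the \<open>q i\<close>, and between blocks for the
  noise vectors over disjoint index sets.\<close>

lemma (in prob_space) prob_no_successful_block_le:
  fixes \<xi> :: "nat \<Rightarrow> 'a \<Rightarrow> real" and A :: "nat \<Rightarrow> real set" and q :: "nat \<Rightarrow> real"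
  assumes ind: "indep_vars (\<lambda>_. borel) \<xi> {1..}"
    and A: "\<And>i. A i \<in> sets borel"
    and q: "\<And>i. 0 \<le> q i"
    and N: "0 < N"
    and prob: "\<And>n i. n \<ge> 1 \<Longrightarrow> i < N \<Longrightarrow> q i \<le> prob {\<omega> \<in> space M. \<xi> n \<omega> \<in> A i}"
  shows "prob {\<omega> \<in> space M. \<forall>j<k. \<exists>i<N. \<xi> (j * N + i + 1) \<omega> \<notin> A i} \<le> (1 - (\<Prod>i<N. q i)) ^ k"
\<comment> \<open>The case \<open>k = 0\<close> is separate because an intersection over no blocks
  would be \<open>UNIV\<close> and not \<open>space M\<close>.\<close>
proof (cases "k = 0")
  case True
  then show ?thesis by auto
next
  case False
  \<comment> \<open>\<open>K j\<close> holds the noise indices of block \<open>j\<close>, shifted by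
    1 because the noise starts at index 1. \<open>W j\<close> is the noise of that block as one
    random vector, and \<open>B j\<close> is the set of vectors for which the block fails.\<close>
  define K where "K j = (\<lambda>i. j * N + i + 1) ` {..<N}" for j
  define B where "B j = {w \<in> space (Pi\<^sub>M (K j) (\<lambda>_. borel :: real measure)). \<exists>i\<in>{..<N}. w (j * N + i + 1) \<notin> A i}" for j
  define W where "W j \<omega> = restrict (\<lambda>i. \<xi> i \<omega>) (K j)" for j \<omega>
  have [measurable]: "\<xi> n \<in> borel_measurable M" if "n \<ge> 1" for n
    using ind that by (auto simp: indep_vars_def)
  have K_div: "(n - 1) div N = j" if "n \<in> K j" for n j
    using that by (auto simp: K_def)
  have "disjoint_family_on K {..<k}"
    unfolding disjoint_family_on_def using K_div by blast
  then have W: "indep_vars (\<lambda>j. Pi\<^sub>M (K j) (\<lambda>_. borel)) W {..<k}"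
    unfolding W_def 
    by (intro indep_vars_restrict[OF ind]) (simp_all, auto simp: K_def)
  have B: "B j \<in> sets (Pi\<^sub>M (K j) (\<lambda>_. borel))" for j
  proof -
    have "(\<lambda>w. w (j * N + i + 1)) \<in> measurable (Pi\<^sub>M (K j) (\<lambda>_. borel :: real measure)) borel" if "i < N" for i
      using that by (intro measurable_component_singleton) (auto simp: K_def)
    then show ?thesis
      unfolding B_def using A by (intro sets.sets_Collect_finite_Ex pred_intros_logic) auto
  qed
  have WB: "W j -` B j \<inter> space M = {\<omega> \<in> space M. \<exists>i<N. \<xi> (j * N + i + 1) \<omega> \<notin> A i}" for j
    by (auto simp: W_def B_def K_def space_PiM)
  have block: "prob (W j -` B j \<inter> space M) \<le> 1 - (\<Prod>i<N. q i)" for j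
  proof -
    \<comment> \<open>For \<open>n\<close> in \<open>K j\<close>, the difference
      \<open>n - 1 - j * N\<close> is the position of \<open>n\<close> inside its block.\<close>
    have fin: "prob (\<Inter>n\<in>K j. \<xi> n -` A (n - 1 - j * N) \<inter> space M)
        = (\<Prod>n\<in>K j. prob (\<xi> n -` A (n - 1 - j * N) \<inter> space M))"
      using N A by (intro indep_varsD[OF ind]) (auto simp: K_def)
    have inj: "inj_on (\<lambda>i. j * N + i + 1) {..<N}" by (auto simp: inj_on_def)
    have "(\<Prod>i<N. q i) \<le> (\<Prod>i<N. prob {\<omega> \<in> space M. \<xi> (j * N + i + 1) \<omega> \<in> A i})"
      using q prob by (intro prod_mono) auto
    also have "\<dots> = (\<Prod>n\<in>K j. prob (\<xi> n -` A (n - 1 - j * N) \<inter> space M))"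
      unfolding K_def prod.reindex[OF inj] by (simp add: vimage_def Collect_conj_eq Int_commute)
    also have "\<dots> = prob (space M - (W j -` B j \<inter> space M))"
      unfolding fin[symmetric] WB using N by (intro arg_cong[where f = prob]) (auto simp: K_def)
    also have "\<dots> = 1 - prob (W j -` B j \<inter> space M)"
    proof (rule prob_compl)
      show "W j -` B j \<inter> space M \<in> events"
        unfolding WB using A by measurable
    qed
    finally show ?thesis by simp
  qed
  have "{\<omega> \<in> space M. \<forall>j<k. \<exists>i<N. \<xi> (j * N + i + 1) \<omega> \<notin> A i} = (\<Inter>j\<in>{..<k}. W j -` B j \<inter> space M)"
    unfolding WB using False by auto
  also have "prob \<dots> = (\<Prod>j<k. prob (W j -` B j \<inter> space M))"
    using False B by (intro indep_varsD[OF W]) auto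
  also have "\<dots> \<le> (\<Prod>j<k. 1 - (\<Prod>i<N. q i))"
    using block by (intro prod_mono) auto
  finally show ?thesis by simp
qed

text \<open>If \<open>J\<close> is the first successful block, then \<open>T\<close> is at most
  \<open>N * Suc J\<close>, and \<open>Suc J\<close> counts the \<open>k\<close> for which the first
  \<open>k\<close> blocks all fail. Integrating this count term by term leaves the geometric series
  with sum 1/p.\<close>

lemma (in prob_space) expectation_le_of_geometric_tail:
  fixes T :: "'a \<Rightarrow> enat" and G :: "nat \<Rightarrow> 'a \<Rightarrow> bool"
  assumes meas [measurable]: "\<And>j. Measurable.pred M (G j)"
    and T: "\<And>\<omega> j. \<omega> \<in> space M \<Longrightarrow> G j \<omega> \<Longrightarrow> T \<omega> \<le> enat (Suc j * N)"
    and tail: "\<And>k. prob {\<omega> \<in> space M. \<forall>j<k. \<not> G j \<omega>} \<le> (1 - p) ^ k"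
    and p: "0 < p" "p \<le> 1" and N: "0 < N"
  shows "(\<integral>\<^sup>+ \<omega>. ennreal_of_enat (T \<omega>) \<partial>M) \<le> ennreal (real N / p)"
proof -
  let ?S = "\<lambda>k. {\<omega> \<in> space M. \<forall>j<k. \<not> G j \<omega>}"
  \<comment> \<open>A pointwise bound by a measurable function, because \<open>T\<close> itself need not be measurable.\<close>
  have pw: "ennreal_of_enat (T \<omega>) \<le> ennreal (real N) * (\<Sum>k. indicator (?S k) \<omega>)" if \<omega>: "\<omega> \<in> space M" for \<omega>
  proof (cases "\<exists>j. G j \<omega>")
    case True
    define J where "J = (LEAST j. G j \<omega>)"
    have J: "G J \<omega>" unfolding J_def using True by (rule LeastI_ex)
    have before: "\<not> G j \<omega>" if "j < J" for j
      using not_less_Least that unfolding J_def by blast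
    \<comment> \<open>The terms \<open>k = 0\<close> to \<open>k = J\<close> all equal 1; the one
      for \<open>k = 0\<close> is vacuous and accounts for the \<open>Suc\<close>.\<close>
    have "(\<Sum>k. indicator (?S k) \<omega> :: ennreal) \<ge> (\<Sum>k<Suc J. indicator (?S k) \<omega>)"
      by (rule sum_le_suminf) auto
    also have "(\<Sum>k<Suc J. indicator (?S k) \<omega> :: ennreal) = (\<Sum>k<Suc J. 1)"
      using before \<omega> by (intro sum.cong) (auto split: split_indicator)
    finally have "ennreal (real (Suc J)) \<le> (\<Sum>k. indicator (?S k) \<omega>)"
      by (simp add: ennreal_of_nat_eq_real_of_nat)
    then have "ennreal (real N) * ennreal (real (Suc J)) \<le> ennreal (real N) * (\<Sum>k. indicator (?S k) \<omega>)"
      by (intro mult_left_mono) auto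
    moreover have "ennreal_of_enat (T \<omega>) \<le> ennreal_of_enat (enat (Suc J * N))"
      using T[OF \<omega> J] by (simp only: ennreal_of_enat_le_iff)
    moreover have "ennreal_of_enat (enat (Suc J * N)) = ennreal (real N) * ennreal (real (Suc J))"
      by (subst ennreal_mult[symmetric]) (auto simp: ennreal_of_nat_eq_real_of_nat algebra_simps)
    ultimately show ?thesis by simp
  next
    \<comment> \<open>If no block ever succeeds, the bound is infinite, so \<open>T\<close> may be
      infinite too. Here \<open>0 < N\<close> matters, since \<open>0 * top = 0\<close> in
      \<open>ennreal\<close>.\<close>
    case False
    then have "(\<Sum>k. indicator (?S k) \<omega> :: ennreal) = (\<Sum>k. 1)"
      using \<omega> by (intro suminf_cong) auto
    also have "(\<Sum>k. 1 :: ennreal) = top"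
      using nn_integral_count_space_nat[of "\<lambda>_. 1"] by (simp add: emeasure_count_space)
    finally show ?thesis using N by (simp add: ennreal_mult_top)
  qed
  have "(\<integral>\<^sup>+ \<omega>. ennreal_of_enat (T \<omega>) \<partial>M) \<le> (\<integral>\<^sup>+ \<omega>. ennreal (real N) * (\<Sum>k. indicator (?S k) \<omega>) \<partial>M)"
    by (intro nn_integral_mono pw)
  also have "\<dots> = ennreal (real N) * (\<Sum>k. emeasure M (?S k))"
    by (simp add: nn_integral_cmult nn_integral_suminf)
  also have "\<dots> \<le> ennreal (real N) * (\<Sum>k. ennreal ((1 - p) ^ k))"
    by (intro mult_left_mono suminf_le) (auto simp: emeasure_eq_measure intro!: ennreal_leI tail)
  also have "(\<Sum>k. ennreal ((1 - p) ^ k)) = ennreal (1 / p)"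
    using geometric_sums[of "1 - p"] p by (intro suminf_ennreal_eq) auto
  also have "ennreal (real N) * ennreal (1 / p) = ennreal (real N / p)"
    using p by (simp add: ennreal_mult[symmetric])
  finally show ?thesis .
qed

section \<open>Steering the path to the boundary\<close>

text \<open>The left side is the noiseless linear system with factor \<open>b\<close>, started at 0
  and driven by the inputs \<open>c * b ^ (N - 1 - i)\<close>. Multiplying the recursion by
  \<open>s\<close> turns \<open>a\<close> into \<open>b\<close>, so the path dominates this system
  in absolute value from any \<open>X 0\<close>.\<close>

lemma steered_path_lower:
  fixes X x :: "nat \<Rightarrow> real"
  assumes a: "b = \<bar>a\<bar>" "\<bar>s\<bar> = 1" "s * a = b" and \<epsilon>: "0 < \<epsilon>" and c: "0 \<le> c"
    and rec: "\<And>i. i < N \<Longrightarrow> X (Suc i) = a * \<bar>X i\<bar> + \<epsilon> * x i"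
    and x: "\<And>i. i < N \<Longrightarrow> c * b ^ (N - 1 - i) / \<epsilon> \<le> s * x i"
  shows "i \<le> N \<Longrightarrow> c * b ^ (N - i) * (\<Sum>l<i. (b\<^sup>2) ^ l) \<le> \<bar>X i\<bar>"
proof (induction i)
  case 0
  then show ?case by simp
next
  case (Suc i)
  then have i: "i < N" by simp
  then have e: "N - i = Suc (N - Suc i)" "N - 1 - i = N - Suc i" by auto
  have b: "0 \<le> b" using a by simp
  have IH: "c * b ^ (N - i) * (\<Sum>l<i. (b\<^sup>2) ^ l) \<le> \<bar>X i\<bar>" using Suc i by simp
  have "(\<Sum>l<Suc i. (b\<^sup>2) ^ l) = 1 + b\<^sup>2 * (\<Sum>l<i. (b\<^sup>2) ^ l)"
    by (subst sum.lessThan_Suc_shift) (simp add: sum_distrib_left)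
  then have "c * b ^ (N - Suc i) * (\<Sum>l<Suc i. (b\<^sup>2) ^ l)
      = b * (c * b ^ (N - i) * (\<Sum>l<i. (b\<^sup>2) ^ l)) + c * b ^ (N - 1 - i)"
    unfolding e by (simp add: algebra_simps power2_eq_square)
  also have "\<dots> \<le> b * \<bar>X i\<bar> + \<epsilon> * (s * x i)"
    using mult_left_mono[OF IH b] x[OF i] \<epsilon> by (intro add_mono) (auto simp: field_simps)
  also have "\<dots> = s * X (Suc i)"
    using a unfolding rec[OF i] by (simp add: algebra_simps flip: a(3))
  also have "\<dots> \<le> \<bar>X (Suc i)\<bar>"
    using a(2) by (metis abs_ge_self abs_mult mult_1)
  finally show ?case .
qed

lemma exit_time_le:
  assumes "n \<ge> 1" "\<bar>X n \<omega>\<bar> \<ge> 1"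
  shows "exit_time X \<omega> \<le> enat n"
  unfolding exit_time_def using assms by (intro Inf_lower) auto

lemma ln_ennreal_le:
  assumes "x \<le> ennreal y" "0 < y"
  shows "ln_ennreal x \<le> ereal (ln y)"
proof (cases "x = 0")
  case True
  then show ?thesis by (simp add: ln_ennreal_def)
next
  case False
  obtain r where r: "x = ennreal r" "0 \<le> r"
    using assms by (cases x) (auto simp: top_unique)
  with False have "0 < r" by (auto simp: less_le)
  moreover have "r \<le> y" using assms r by (simp add: ennreal_le_iff)
  ultimately show ?thesis using r by (simp add: ln_ennreal_def)
qed

text \<open>The constant \<open>c\<close> makes the steered system end exactly at 1 after
  \<open>N\<close> steps. A block whose noises all pass their thresholds is then a success in the
  geometric tail argument, and the product bounds its probability from below.\<close>

lemma expected_exit_time_le: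
  fixes \<xi> :: "nat \<Rightarrow> 'a \<Rightarrow> real"
  assumes M: "prob_space M"
    and ind: "prob_space.indep_vars M (\<lambda>_. borel) \<xi> {1..}"
    and dist: "\<And>n. n \<ge> 1 \<Longrightarrow> distributed M lborel (\<xi> n) std_normal_density"
    and f: "\<And>x. x \<in> {-1..1} \<Longrightarrow> f x = a * \<bar>x\<bar>"
    and N: "0 < N" and \<epsilon>: "0 < \<epsilon>"
  defines "c \<equiv> 1 / (\<Sum>l<N. (a\<^sup>2) ^ l)"
  shows "(\<integral>\<^sup>+ \<omega>. ennreal_of_enat (exit_time (perturbed f \<xi> \<epsilon>) \<omega>) \<partial>M)
    \<le> ennreal (real N / (\<Prod>i<N. exp (- (c * \<bar>a\<bar> ^ (N - 1 - i) / \<epsilon> + 1)\<^sup>2 / 2) / sqrt (2 * pi)))"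
proof -
  interpret prob_space M by fact
  define s :: real where "s = (if a < 0 then -1 else 1)"
  define t where "t i = c * \<bar>a\<bar> ^ (N - 1 - i) / \<epsilon>" for i
  define A where "A i = {y. t i \<le> s * y}" for i
  define q where "q i = exp (- (t i + 1)\<^sup>2 / 2) / sqrt (2 * pi)" for i
  define G where "G j \<omega> \<longleftrightarrow> (\<forall>i<N. \<xi> (j * N + i + 1) \<omega> \<in> A i)" for j \<omega>
  \<comment> \<open>The term \<open>l = 0\<close> is 1, even for \<open>a = 0\<close>.\<close>
  have pos: "0 < (\<Sum>l<N. (a\<^sup>2) ^ l)"
    using N by (intro sum_pos2[of _ 0]) auto
  then have c: "0 < c" by (simp add: c_def)
  have [measurable]: "\<xi> n \<in> borel_measurable M" if "n \<ge> 1" for n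
    using ind that by (auto simp: indep_vars_def)
  have A [measurable]: "A i \<in> sets borel" for i
    unfolding A_def by measurable
  have q: "0 < q i" "q i \<le> 1" for i
  proof -
    have "1 \<le> sqrt (2 * pi)" using pi_gt3 by (intro real_le_rsqrt) simp
    moreover have "exp (- (t i + 1)\<^sup>2 / 2) \<le> 1" by simp
    ultimately show "q i \<le> 1" unfolding q_def by (subst divide_le_eq_1_pos) linarith+
  qed (simp add: q_def)
  have tail: "prob {\<omega> \<in> space M. \<forall>j<k. \<not> G j \<omega>} \<le> (1 - (\<Prod>i<N. q i)) ^ k" for k
  proof -
    have "q i \<le> prob {\<omega> \<in> space M. \<xi> n \<omega> \<in> A i}" if "n \<ge> 1" for n i
      using std_normal_signed_tail_lower[OF dist[OF that], of "t i" s] c \<epsilon>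
      by (simp add: q_def A_def s_def t_def)
    then have "prob {\<omega> \<in> space M. \<forall>j<k. \<exists>i<N. \<xi> (j * N + i + 1) \<omega> \<notin> A i} \<le> (1 - (\<Prod>i<N. q i)) ^ k"
      using q less_imp_le by (intro prob_no_successful_block_le ind A N) blast+
    then show ?thesis by (simp add: G_def)
  qed
  have exit: "exit_time (perturbed f \<xi> \<epsilon>) \<omega> \<le> enat (Suc j * N)" if G: "G j \<omega>" for j \<omega>
  \<comment> \<open>Either the path has left by the end of block \<open>j\<close>, or it stayed
    inside throughout. In the second case \<open>f\<close> has its known form along the whole block,
    and steering gives a contradiction.\<close>
  proof (cases "\<exists>n\<ge>1. n \<le> Suc j * N \<and> \<bar>perturbed f \<xi> \<epsilon> n \<omega>\<bar> \<ge> 1")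
    case True
    then show ?thesis
      by (meson enat_ord_simps(1) exit_time_le order_trans)
  next
    case False
    define X where "X i = perturbed f \<xi> \<epsilon> (j * N + i) \<omega>" for i
    have inside: "\<bar>X i\<bar> < 1" if "i \<le> N" for i
    \<comment> \<open>Time 0 does not count as an exit time, so there the bound comes from the
      initial value 0.\<close>
    proof (cases "j * N + i = 0")
      case True
      then show ?thesis unfolding X_def by (subst True) simp
    next
      case nz: False
      then have "1 \<le> j * N + i" by linarith
      moreover have "j * N + i \<le> Suc j * N" using that by simp
      ultimately show ?thesis unfolding X_def using False not_le by blast
    qed
    have "c * \<bar>a\<bar> ^ (N - N) * (\<Sum>l<N. (\<bar>a\<bar>\<^sup>2) ^ l) \<le> \<bar>X N\<bar>"
    proof (rule steered_path_lower[where s = s and \<epsilon> = \<epsilon> and x = "\<lambda>i. \<xi> (j * N + i + 1) \<omega>"])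
      fix i assume i: "i < N"
      show "X (Suc i) = a * \<bar>X i\<bar> + \<epsilon> * \<xi> (j * N + i + 1) \<omega>"
        using f[of "X i"] inside[of i] i by (simp add: X_def abs_le_iff abs_less_iff)
      show "c * \<bar>a\<bar> ^ (N - 1 - i) / \<epsilon> \<le> s * \<xi> (j * N + i + 1) \<omega>"
        using G i by (auto simp: G_def A_def t_def)
    qed (use c \<epsilon> in \<open>auto simp: s_def\<close>)
    then have "1 \<le> \<bar>X N\<bar>" using pos by (simp add: c_def)
    with inside[of N] show ?thesis by simp
  qed
  have "(\<integral>\<^sup>+ \<omega>. ennreal_of_enat (exit_time (perturbed f \<xi> \<epsilon>) \<omega>) \<partial>M) \<le> ennreal (real N / (\<Prod>i<N. q i))"
  proof (rule expectation_le_of_geometric_tail[where G = G])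
    show "Measurable.pred M (G j)" for j
      unfolding G_def by measurable
    show "(\<Prod>i<N. q i) \<le> 1" using q less_imp_le by (intro prod_le_1) blast
    show "0 < (\<Prod>i<N. q i)" using q by (intro prod_pos) blast
  qed (use exit tail N in auto)
  then show ?thesis by (simp add: q_def t_def)
qed

section \<open>Small noise limit for fixed block length, then long blocks\<close>

lemma Limsup_expected_exit_time_le:
  fixes \<xi> :: "nat \<Rightarrow> 'a \<Rightarrow> real"
  assumes M: "prob_space M"
    and ind: "prob_space.indep_vars M (\<lambda>_. borel) \<xi> {1..}"
    and dist: "\<And>n. n \<ge> 1 \<Longrightarrow> distributed M lborel (\<xi> n) std_normal_density"
    and f: "\<And>x. x \<in> {-1..1} \<Longrightarrow> f x = a * \<bar>x\<bar>"
    and N: "0 < N"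
  shows "Limsup (at_right 0) (\<lambda>\<epsilon>::real. ereal (\<epsilon>\<^sup>2) *
           ln_ennreal (\<integral>\<^sup>+ \<omega>. ennreal_of_enat (exit_time (perturbed f \<xi> \<epsilon>) \<omega>) \<partial>M))
         \<le> ereal (1 / (2 * (\<Sum>l<N. (a\<^sup>2) ^ l)))"
proof -
  define S where "S = (\<Sum>l<N. (a\<^sup>2) ^ l)"
  define L where "L = ln (sqrt (2 * pi))"
  define v where "v i = \<bar>a\<bar> ^ (N - 1 - i) / S" for i
  \<comment> \<open>\<open>h\<close> is eps^2 * log (N / p) with the factor eps^2 multiplied into
    the squares. This removes every division by eps, so \<open>h\<close> is a polynomial, continuous
    at 0.\<close>
  define h where "h \<epsilon> = \<epsilon>\<^sup>2 * ln (real N) + (\<Sum>i<N. (v i + \<epsilon>)\<^sup>2 / 2 + \<epsilon>\<^sup>2 * L)" for \<epsilon>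
  have S: "0 < S" unfolding S_def using N by (intro sum_pos2[of _ 0]) auto
  have bound: "ereal (\<epsilon>\<^sup>2) * ln_ennreal (\<integral>\<^sup>+ \<omega>. ennreal_of_enat (exit_time (perturbed f \<xi> \<epsilon>) \<omega>) \<partial>M)
      \<le> ereal (h \<epsilon>)" if \<epsilon>: "0 < \<epsilon>" for \<epsilon>
  proof -
    define q where "q i = exp (- (v i / \<epsilon> + 1)\<^sup>2 / 2) / sqrt (2 * pi)" for i
    have q: "0 < q i" for i by (simp add: q_def)
    have "ln_ennreal (\<integral>\<^sup>+ \<omega>. ennreal_of_enat (exit_time (perturbed f \<xi> \<epsilon>) \<omega>) \<partial>M)
        \<le> ereal (ln (real N / (\<Prod>i<N. q i)))"
    proof (rule ln_ennreal_le)
      show "0 < real N / (\<Prod>i<N. q i)"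
        using N q by (intro divide_pos_pos prod_pos) auto
      show "(\<integral>\<^sup>+ \<omega>. ennreal_of_enat (exit_time (perturbed f \<xi> \<epsilon>) \<omega>) \<partial>M) \<le> ennreal (real N / (\<Prod>i<N. q i))"
        using expected_exit_time_le[OF M ind dist f N \<epsilon>] by (simp add: q_def v_def S_def)
    qed
    then have "ereal (\<epsilon>\<^sup>2) * ln_ennreal (\<integral>\<^sup>+ \<omega>. ennreal_of_enat (exit_time (perturbed f \<xi> \<epsilon>) \<omega>) \<partial>M)
        \<le> ereal (\<epsilon>\<^sup>2) * ereal (ln (real N / (\<Prod>i<N. q i)))"
      by (rule ereal_mult_left_mono) simp
    also have "ln (real N / (\<Prod>i<N. q i)) = ln (real N) - (\<Sum>i<N. ln (q i))"
      using N q by (simp add: ln_div ln_prod prod_pos less_imp_neq[symmetric])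
    also have "\<dots> = ln (real N) + (\<Sum>i<N. (v i / \<epsilon> + 1)\<^sup>2 / 2 + L)"
      by (simp add: q_def L_def ln_div add.commute flip: sum_negf)
    also have "ereal (\<epsilon>\<^sup>2) * ereal \<dots> = ereal (h \<epsilon>)"
    proof -
      have "\<epsilon>\<^sup>2 * ((v i / \<epsilon> + 1)\<^sup>2 / 2 + L) = (v i + \<epsilon>)\<^sup>2 / 2 + \<epsilon>\<^sup>2 * L" for i
        using \<epsilon> by (simp add: field_simps power2_eq_square)
      then show ?thesis by (simp add: h_def distrib_left sum_distrib_left)
    qed
    finally show ?thesis .
  qed
  have "(h \<longlongrightarrow> h 0) (at_right 0)"
    unfolding h_def by (intro tendsto_intros) auto
  then have lim: "((\<lambda>\<epsilon>. ereal (h \<epsilon>)) \<longlongrightarrow> ereal (h 0)) (at_right 0)"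
    by simp
  \<comment> \<open>At 0 only half the control energy survives: the squares of the
    \<open>v i\<close> add up to \<open>S / S\<^sup>2\<close>.\<close>
  have "h 0 = (\<Sum>i<N. (\<bar>a\<bar> ^ (N - Suc i))\<^sup>2) / S\<^sup>2 / 2"
    by (simp add: h_def v_def power_divide sum_divide_distrib)
  also have "(\<Sum>i<N. (\<bar>a\<bar> ^ (N - Suc i))\<^sup>2) = (\<Sum>i<N. (\<bar>a\<bar> ^ i)\<^sup>2)"
    by (rule sum.nat_diff_reindex)
  also have "\<dots> = S"
    unfolding S_def by (simp add: power_mult[symmetric] mult.commute[of _ 2]) (simp add: power_mult)
  also have "S / S\<^sup>2 / 2 = 1 / (2 * S)"
    using S by (simp add: power2_eq_square)
  finally have h0: "h 0 = 1 / (2 * S)" .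
  have "Limsup (at_right 0) (\<lambda>\<epsilon>::real. ereal (\<epsilon>\<^sup>2) *
           ln_ennreal (\<integral>\<^sup>+ \<omega>. ennreal_of_enat (exit_time (perturbed f \<xi> \<epsilon>) \<omega>) \<partial>M))
      \<le> Limsup (at_right 0) (\<lambda>\<epsilon>. ereal (h \<epsilon>))"
    using bound by (intro Limsup_mono eventually_at_rightI[of 0 1]) auto
  also have "\<dots> = ereal (h 0)"
    using lim by (intro lim_imp_Limsup) auto
  finally show ?thesis by (simp add: h0 S_def)
qed

theorem mainTheorem8:
  fixes M :: "'a measure" and \<xi> :: "nat \<Rightarrow> 'a \<Rightarrow> real"
    and a :: real and f :: "real \<Rightarrow> real"
  assumes "prob_space M"
    and "prob_space.indep_vars M (\<lambda>_. borel) \<xi> {1..}"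
    and "\<And>n. n \<ge> 1 \<Longrightarrow> distributed M lborel (\<xi> n) std_normal_density"
    and "\<bar>a\<bar> < 1"
    and "continuous_on UNIV f"
    and "\<And>x. x \<in> {-1..1} \<Longrightarrow> f x = a * \<bar>x\<bar>"
  shows "Limsup (at_right 0) (\<lambda>\<epsilon>::real. ereal (\<epsilon>\<^sup>2) *
           ln_ennreal (\<integral>\<^sup>+ \<omega>. ennreal_of_enat (exit_time (perturbed f \<xi> \<epsilon>) \<omega>) \<partial>M))
         \<le> ereal ((1 - a\<^sup>2) / 2)"
proof (rule tendsto_lowerbound)
  \<comment> \<open>The limsup does not depend on \<open>N\<close>, so the bounds for fixed
    \<open>N\<close> pass to the limit, where the geometric sum becomes
    \<open>1 / (1 - a\<^sup>2)\<close>.\<close>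
  have a2: "a\<^sup>2 < 1" using assms(4) by (simp add: abs_square_less_1)
  then have "(\<lambda>N. \<Sum>l<N. (a\<^sup>2) ^ l) \<longlonglongrightarrow> 1 / (1 - a\<^sup>2)"
    using geometric_sums[of "a\<^sup>2"] by (simp add: sums_def)
  then have "(\<lambda>N. 1 / (2 * (\<Sum>l<N. (a\<^sup>2) ^ l))) \<longlonglongrightarrow> 1 / (2 * (1 / (1 - a\<^sup>2)))"
    using a2 by (intro tendsto_intros) auto
  then show "(\<lambda>N. ereal (1 / (2 * (\<Sum>l<N. (a\<^sup>2) ^ l)))) \<longlonglongrightarrow> ereal ((1 - a\<^sup>2) / 2)"
    by simp
  show "\<forall>\<^sub>F N in sequentially. Limsup (at_right 0) (\<lambda>\<epsilon>::real. ereal (\<epsilon>\<^sup>2) *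
           ln_ennreal (\<integral>\<^sup>+ \<omega>. ennreal_of_enat (exit_time (perturbed f \<xi> \<epsilon>) \<omega>) \<partial>M))
         \<le> ereal (1 / (2 * (\<Sum>l<N. (a\<^sup>2) ^ l)))"
    using eventually_gt_at_top[of 0]
    by eventually_elim (rule Limsup_expected_exit_time_le[OF assms(1,2,3,6)])
qed simp

end
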